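(* Suppose that for all infinite cardinals $\lambda<\kappa$ one has $\lambda^{\aleph_0}\le\kappa$. Then every compact Hausdorff space $X$ such that the cofinality of $\mathrm{Nt}(X)$ is uncountable satisfies $\mathrm{Nt}(X_\delta)\le \mathrm{Nt}(X)^+$.
   Context: For a cardinal $\kappa$, a family $\mathcal B$ of sets is called $\kappa^{\mathrm{op}}$-like if for every $U\in\mathcal B$ the set $\{V\in\mathcal B: U\subseteq V\}$ has cardinality $<\kappa$. The Noetherian type $\mathrm{Nt}(X)$ of a topological space $X$ is the least infinite cardinal $\kappa$ such that $X$ has a base which is $\kappa^{\mathrm{op}}$-like. $X_\delta$ (the $G_\delta$-modification of $X$) is the set $X$ with the topology generated by all $G_\delta$ subsets of $X$. *)

theory Defs
  imports "HOL-Analysis.Analysis"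
begin

unbundle cardinal_syntax

definition is_base :: "'a set set \<Rightarrow> 'a topology \<Rightarrow> bool" where
  "is_base B X \<longleftrightarrow> openin X = arbitrary union_of (\<lambda>U. U \<in> B)"

definition op_like :: "'k rel \<Rightarrow> 'a set set \<Rightarrow> bool" where
  "op_like k B \<longleftrightarrow> (\<forall>U\<in>B. |{V \<in> B. U \<subseteq> V}| <o k)"

definition has_op_like_base :: "'k rel \<Rightarrow> 'a topology \<Rightarrow> bool" where
  "has_op_like_base k X \<longleftrightarrow> (\<exists>B. is_base B X \<and> op_like k B)"

text \<open>Cardinals are well-orders on some carrier type, compared up to order isomorphism. A base of
  a topology on \<open>'a\<close> has at most as many members as \<open>'a set\<close>, so the type \<open>(nat + 'a set) set\<close> is
  large enough to carry the Noetherian type of every topology on \<open>'a\<close>. The lemmas \<open>Noetherian_type\<close>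
  and \<open>Noetherian_type_least\<close> below confirm that the choice is well defined and that
  minimality holds among cardinals on arbitrary types.\<close>

definition Nt :: "'a topology \<Rightarrow> (nat + 'a set) set rel" where
  "Nt X = (SOME k. Cinfinite k \<and> has_op_like_base k X \<and>
      (\<forall>k' :: (nat + 'a set) set rel. Cinfinite k' \<and> has_op_like_base k' X \<longrightarrow> k \<le>o k'))"

definition G_delta_modification :: "'a topology \<Rightarrow> 'a topology" where
  "G_delta_modification X = topology_generated_by {S. gdelta_in X S}"

text \<open>The library's \<open>cofinal A r\<close> asks for strictly larger elements of \<open>A\<close>. On infinite cardinals,
  which have no greatest element, this is the usual notion of an unbounded subset.\<close>

definition cofinality :: "'k rel \<Rightarrow> 'k rel" where
  "cofinality r = |SOME A. A \<subseteq> Field r \<and> cofinal A r \<and>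
      (\<forall>B. B \<subseteq> Field r \<and> cofinal B r \<longrightarrow> |A| \<le>o |B| )|"

lemma op_like_mono:
  assumes "op_like k B" "k \<le>o k'"
  shows "op_like k' B"
  using assms ordLess_ordLeq_trans unfolding op_like_def by blast

lemma op_like_large: "op_like |UNIV :: (nat + 'a set) set set| (B :: 'a set set)"
  unfolding op_like_def
proof
  fix U assume "U \<in> B"
  have "|{V \<in> B. U \<subseteq> V}| \<le>o |UNIV :: (nat + 'a set) set|"
    by (rule card_of_ordLeqI[where f = Inr]) auto
  also have "|UNIV :: (nat + 'a set) set| <o |UNIV :: (nat + 'a set) set set|"
    using card_of_Pow[of "UNIV :: (nat + 'a set) set"] by simp
  finally (ordLeq_ordLess_trans) show "|{V \<in> B. U \<subseteq> V}| <o |UNIV :: (nat + 'a set) set set|" .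
qed

lemma Cinfinite_large: "Cinfinite |UNIV :: (nat + 'a set) set set|"
  proof -
  have "infinite (UNIV :: (nat + 'a set) set set)"
    by (simp add: Finite_Set.finite_set)
  then show ?thesis
    unfolding cinfinite_def by (simp add: Field_card_of card_of_card_order_on)
qed

lemma Nt_some:
  fixes X :: "'a topology"
  shows "Cinfinite (Nt X) \<and> has_op_like_base (Nt X) X \<and>
    (\<forall>k' :: (nat + 'a set) set rel. Cinfinite k' \<and> has_op_like_base k' X \<longrightarrow> Nt X \<le>o k')"
proof -
  let ?R = "{k :: (nat + 'a set) set rel. Cinfinite k \<and> has_op_like_base k X}"
  have "is_base {U. openin X U} X"
    unfolding is_base_def openin_topology_base_unique by auto
  then have "has_op_like_base |UNIV :: (nat + 'a set) set set| X"
    unfolding has_op_like_base_def using op_like_large by blast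
  then have "?R \<noteq> {}" using Cinfinite_large by blast
  then have "\<exists>k\<in>?R. \<forall>k'\<in>?R. k \<le>o k'"
    by (intro exists_minim_Card_order) auto
  then have "\<exists>k :: (nat + 'a set) set rel. Cinfinite k \<and> has_op_like_base k X \<and>
      (\<forall>k' :: (nat + 'a set) set rel. Cinfinite k' \<and> has_op_like_base k' X \<longrightarrow> k \<le>o k')"
    by blast
  then show ?thesis unfolding Nt_def by (rule someI_ex)
qed

lemma Noetherian_type:
  shows "Cinfinite (Nt X)" and "has_op_like_base (Nt X) X"
  using Nt_some[of X] by auto

lemma Noetherian_type_least:
  fixes X :: "'a topology" and k :: "'k rel"
  assumes k: "Cinfinite k" and b: "has_op_like_base k X"
  shows "Nt X \<le>o k"
proof (rule ccontr)
  assume "\<not> Nt X \<le>o k"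
  then have less: "k <o Nt X"
    using k Noetherian_type(1)[of X] by (meson card_order_on_well_order_on not_ordLeq_iff_ordLess)
  then obtain p :: "(nat + 'a set) set rel" where p: "(k, p) \<in> ordIso" "p <o Nt X"
    using internalize_ordLess[of k "Nt X"] by blast
  have "Cinfinite p" using p(1) k Cinfinite_cong by blast
  moreover have "has_op_like_base p X"
    using b p(1) op_like_mono ordIso_imp_ordLeq unfolding has_op_like_base_def by blast
  ultimately have "Nt X \<le>o p" using Nt_some[of X] by blast
  then show False using p(2) not_ordLess_ordLeq by blast
qed

lemma topspace_G_delta_modification: "topspace (G_delta_modification X) = topspace X"
proof -
  have "gdelta_in X (topspace X)" by (simp add: open_imp_gdelta_in)
  then show ?thesis
    unfolding G_delta_modification_def topology_generated_by_topspace
    using gdelta_in_subset by blast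
qed

lemma cofinality_least:
  assumes "Cinfinite r"
  shows "\<exists>A. A \<subseteq> Field r \<and> cofinal A r \<and> cofinality r = |A|"
    and "B \<subseteq> Field r \<Longrightarrow> cofinal B r \<Longrightarrow> cofinality r \<le>o |B|"
proof -
  have "cofinal (Field r) r"
    unfolding cofinal_def
  proof
    fix a assume "a \<in> Field r"
    with assms show "\<exists>b\<in>Field r. a \<noteq> b \<and> (a, b) \<in> r"
      by (intro infinite_Card_order_limit) (auto simp: cinfinite_def)
  qed
  then have ne: "card_of ` {A. A \<subseteq> Field r \<and> cofinal A r} \<noteq> {}" by blast
  have "\<exists>k \<in> card_of ` {A. A \<subseteq> Field r \<and> cofinal A r}.
      \<forall>k' \<in> card_of ` {A. A \<subseteq> Field r \<and> cofinal A r}. k \<le>o k'"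
    by (rule exists_minim_Card_order[OF ne]) (auto simp del: Field_card_of intro: card_of_Card_order)
  then have "\<exists>A. A \<subseteq> Field r \<and> cofinal A r \<and>
      (\<forall>B. B \<subseteq> Field r \<and> cofinal B r \<longrightarrow> |A| \<le>o |B| )"
    by blast
  from someI_ex[OF this]
  show "\<exists>A. A \<subseteq> Field r \<and> cofinal A r \<and> cofinality r = |A|"
    and "B \<subseteq> Field r \<Longrightarrow> cofinal B r \<Longrightarrow> cofinality r \<le>o |B|"
    unfolding cofinality_def by blast+
qed

end

theory Submission
  imports Defs
begin

text \<open>
  Write \<open>\<kappa>\<close> for the Noetherian type of \<open>X\<close> and fix a \<open>\<kappa>\<close>-op-like base \<open>B\<close> of \<open>X\<close>. The base of the
  \<open>G\<^sub>\<delta>\<close>-modification that witnesses the bound consists of the nonempty sets \<open>\<Inter>n. U n\<close>, where \<open>U\<close>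
  is a sequence in \<open>B\<close> with \<open>X closure_of U (Suc n) \<subseteq> U n\<close>; regularity of \<open>X\<close> makes these sets a base
  (\<open>is_base_nested_intersections\<close>).

  Suppose that \<open>G = (\<Inter>n. U n)\<close> is contained in \<open>H = (\<Inter>n. V n)\<close>, both from this base. As \<open>G\<close> is also
  the intersection of the decreasing sequence of the compact closures of the \<open>U n\<close>, every \<open>V n\<close>
  contains some \<open>U m\<close> (\<open>nested_intersection_subset_open\<close>). So all \<open>V n\<close> lie in
  \<open>D = (\<Union>m. {V \<in> B. U m \<subseteq> V})\<close>, a set that does not depend on \<open>H\<close>. It is a countable union of sets of
  size \<open>< \<kappa>\<close>, hence itself of size \<open>< \<kappa>\<close> because \<open>\<kappa>\<close> has uncountable cofinality
  (\<open>card_of_countable_UN_ordLess\<close>). The arithmetical hypothesis on \<open>\<kappa>\<close> leaves at most \<open>\<kappa>\<close> sequences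
  in \<open>D\<close> (\<open>card_of_sequences_ordLeq\<close>), and therefore at most \<open>\<kappa>\<close> members \<open>H\<close> of the new base above \<open>G\<close>:
  the new base is op-like for the successor of \<open>\<kappa>\<close>.
\<close>

section \<open>Cardinals of uncountable cofinality\<close>

lemma natLeq_ordLess_if_uncountable_cofinality:
  assumes r: "Cinfinite r" and cof: "natLeq <o cofinality r"
  shows "natLeq <o r"
proof -
  obtain A where "A \<subseteq> Field r" and eq: "cofinality r = |A|"
    using cofinality_least(1)[OF r] by blast
  then have "|A| \<le>o |Field r|" by (simp add: card_of_mono1)
  moreover have "|Field r| =o r" using r by (simp add: card_of_Field_ordIso)
  ultimately show ?thesis
    using cof unfolding eq by (meson ordLeq_ordIso_trans ordLess_ordLeq_trans)
qed

text \<open>Each \<open>A n\<close> has the size of a proper initial segment of \<open>r\<close>. The countably many end points of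
  these segments are not cofinal in \<open>r\<close>, so a single proper initial segment bounds all sizes; the
  union has at most the size of this segment times \<open>\<aleph>\<^sub>0\<close>.\<close>

lemma card_of_countable_UN_ordLess:
  fixes A :: "nat \<Rightarrow> 'b set"
  assumes r: "Cinfinite r" and cof: "natLeq <o cofinality r" and A: "\<And>n. |A n| <o r"
  shows "|\<Union>n. A n| <o r"
proof -
  have wo: "Well_order r" using r by (simp add: card_order_on_well_order_on)
  have "\<exists>a\<in>Field r. |A n| \<le>o |underS r a|" for n
  proof -
    obtain a where a: "a \<in> Field r" "|A n| =o Restr r (underS r a)"
      using A[of n] ordLess_iff_ordIso_Restr[OF wo card_of_Well_order] by blast
    have "|A n| \<le>o |Field (Restr r (underS r a))|"
      using card_of_mono2[OF ordIso_imp_ordLeq[OF a(2)]] by (simp only: Field_card_of)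
    also have "|Field (Restr r (underS r a))| \<le>o |underS r a|"
      by (rule card_of_mono1) (auto simp: Field_def)
    finally show ?thesis using a(1) by blast
  qed
  then obtain a where a: "\<And>n. a n \<in> Field r" "\<And>n. |A n| \<le>o |underS r (a n)|" by metis
  have "\<not> cofinal (range a) r"
  proof
    assume "cofinal (range a) r"
    then have "cofinality r \<le>o |range a|"
      using a(1) by (intro cofinality_least(2)[OF r]) auto
    also have "|range a| \<le>o |UNIV :: nat set|" by (rule card_of_image)
    also have "|UNIV :: nat set| =o natLeq" by (rule card_of_nat)
    finally show False using cof not_ordLess_ordLeq by blast
  qed
  then obtain b where b: "b \<in> Field r" and le: "\<And>n. b \<noteq> a n \<Longrightarrow> (b, a n) \<notin> r"
    unfolding cofinal_def by blast
  have lin: "Total r" "Refl r" "trans r" "antisym r"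
    using wo by (auto simp: well_order_on_def linear_order_on_def partial_order_on_def preorder_on_def)
  have ab: "(a n, b) \<in> r" for n
    using lin(1,2) le[of n] a(1)[of n] b by (cases "a n = b") (auto simp: total_on_def refl_on_def)
  have bound: "|A n| \<le>o |underS r b|" for n
    by (rule ordLeq_transitive[OF a(2) card_of_mono1[OF underS_incr[OF lin(3,4) ab]]])
  have small: "|underS r b| <o r" using r b by (simp add: card_of_underS)
  show ?thesis
  proof (cases "finite (underS r b)")
    case True
    \<comment> \<open>In this case the union is merely countable.\<close>
    have "|\<Union>n. A n| \<le>o natLeq"
    proof (rule UNION_Cinfinite_bound)
      show "|UNIV :: nat set| \<le>o natLeq" using card_of_nat ordIso_imp_ordLeq by blast
      show "\<forall>n\<in>UNIV. |A n| \<le>o natLeq"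
        using True bound by (meson card_of_ordLeq_finite finite_iff_ordLess_natLeq ordLess_imp_ordLeq)
    qed (rule natLeq_Cinfinite)
    then show ?thesis
      using natLeq_ordLess_if_uncountable_cofinality[OF r cof] ordLeq_ordLess_trans by blast
  next
    case False
    then have "Cinfinite |underS r b|" by (simp add: cinfinite_def Field_card_of card_of_card_order_on)
    moreover have "|UNIV :: nat set| \<le>o |underS r b|"
      using False by (simp flip: infinite_iff_card_of_nat)
    ultimately have "|\<Union>n. A n| \<le>o |underS r b|"
      using bound by (intro UNION_Cinfinite_bound) auto
    then show ?thesis using small ordLeq_ordLess_trans by blast
  qed
qed

text \<open>The hypothesis \<open>pow\<close> speaks of infinite cardinals on the carrier type of \<open>r\<close> only, while \<open>D\<close> may
  be finite and lives on another type. So \<open>D\<close> is enlarged by \<open>\<aleph>\<^sub>0\<close>, and the cardinal obtained is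
  copied into the type of \<open>r\<close>.\<close>

lemma card_of_sequences_ordLeq:
  fixes r :: "'k rel" and D :: "'b set"
  assumes pow: "\<forall>l :: 'k rel. Cinfinite l \<and> l <o r \<longrightarrow> l ^c natLeq \<le>o r"
    and r: "Cinfinite r" and nat: "natLeq <o r" and D: "|D| <o r"
  shows "|{s :: nat \<Rightarrow> 'b. range s \<subseteq> D}| \<le>o r"
proof -
  let ?l = "|D| +c natLeq"
  have "|UNIV :: nat set| <o r" using nat card_of_nat ordIso_ordLess_trans by blast
  then have "?l <o r"
    unfolding csum_def Field_card_of Field_natLeq
    using r D by (intro card_of_Plus_ordLess_infinite_Field) (auto simp: cinfinite_def)
  then obtain p :: "'k rel" where p: "?l =o p" "p <o r"
    using internalize_ordLess[of ?l r] by blast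
  have "Cinfinite ?l" by (simp add: Cinfinite_csum natLeq_Cinfinite)
  then have "Cinfinite p" using p(1) Cinfinite_cong by blast
  then have "p ^c natLeq \<le>o r" using pow p(2) by blast
  moreover have "|D| ^c natLeq \<le>o p ^c natLeq"
  proof (rule cexp_mono1)
    show "|D| \<le>o p"
      using ordLeq_csum1[OF card_of_Card_order] p(1) ordLeq_ordIso_trans by blast
  qed (rule natLeq_Card_order)
  moreover have "|D| ^c natLeq = |{s :: nat \<Rightarrow> 'b. range s \<subseteq> D}|"
    unfolding cexp_def Field_card_of Field_natLeq Func_def by (simp add: image_subset_iff)
  ultimately show ?thesis using ordLeq_transitive by metis
qed

section \<open>Intersections of nested sequences from a base\<close>

definition nested :: "'a topology \<Rightarrow> (nat \<Rightarrow> 'a set) \<Rightarrow> bool" where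
  "nested X U \<longleftrightarrow> (\<forall>n. openin X (U n) \<and> X closure_of U (Suc n) \<subseteq> U n)"

text \<open>The empty set is left out because it lies below every member of the base.\<close>

definition nested_intersections :: "'a set set \<Rightarrow> 'a topology \<Rightarrow> 'a set set" where
  "nested_intersections B X =
    {G. G \<noteq> {} \<and> (\<exists>U. range U \<subseteq> B \<and> nested X U \<and> G = (\<Inter>n. U n))}"

lemma nested_subset_closure: "nested X U \<Longrightarrow> U n \<subseteq> X closure_of U n"
  by (simp add: nested_def closure_of_subset openin_subset)

text \<open>Otherwise the sets \<open>X closure_of U n - W\<close> are a decreasing sequence of nonempty closed sets; by
  compactness they have a common point, which lies in all \<open>U n\<close> because \<open>U\<close> is nested.\<close>

lemma nested_intersection_subset_open:
  assumes X: "compact_space X" and U: "nested X U" and W: "openin X W" and sub: "(\<Inter>n. U n) \<subseteq> W"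
  shows "\<exists>m. U m \<subseteq> W"
proof (rule ccontr)
  assume no: "\<nexists>m. U m \<subseteq> W"
  let ?C = "\<lambda>n. X closure_of U n - W"
  have "(\<Inter>n. ?C n) \<noteq> {}"
  proof (rule compact_space_imp_nest[OF X])
    show "closedin X (?C n)" for n using W by (simp add: closedin_diff)
    show "?C n \<noteq> {}" for n using no nested_subset_closure[OF U, of n] by blast
    show "decseq ?C"
      using U nested_subset_closure[OF U] unfolding nested_def decseq_Suc_iff by blast
  qed
  then obtain x where x: "\<And>n. x \<in> X closure_of U n" "x \<notin> W" by blast
  then have "x \<in> (\<Inter>n. U n)" using U unfolding nested_def by blast
  then show False using sub x(2) by blast
qed

lemma ex_base_element_closure_subset:
  assumes X: "regular_space X" and B: "is_base B X" and W: "openin X W" "x \<in> W"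
  shows "\<exists>V\<in>B. x \<in> V \<and> X closure_of V \<subseteq> W"
proof -
  obtain U C where U: "openin X U" "closedin X C" "x \<in> U" "U \<subseteq> C" "C \<subseteq> W"
    using X W unfolding neighbourhood_base_of_closedin[symmetric] neighbourhood_base_of by metis
  then obtain V where "V \<in> B" "x \<in> V" "V \<subseteq> U"
    using B unfolding is_base_def openin_topology_base_unique by metis
  moreover from this have "X closure_of V \<subseteq> C" using U by (intro closure_of_minimal) auto
  ultimately show ?thesis using U by blast
qed

text \<open>For \<open>S = (\<Inter>n. C n)\<close> with open \<open>C n\<close>, regularity allows a recursive choice of neighbourhoods
  \<open>U n\<close> of \<open>x\<close> in \<open>B\<close>, the closure of each inside the previous one and inside \<open>C n\<close>.\<close>

lemma gdelta_contains_nested_intersection: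
  assumes X: "regular_space X" and B: "is_base B X" and S: "gdelta_in X S" "x \<in> S"
  shows "\<exists>G\<in>nested_intersections B X. x \<in> G \<and> G \<subseteq> S"
proof -
  obtain C :: "nat \<Rightarrow> 'a set" where C: "\<And>n. openin X (C n)" and S_eq: "S = (\<Inter>n. C n)"
    using S(1) unfolding gdelta_in_descending by metis
  have open_B: "\<And>V. V \<in> B \<Longrightarrow> openin X V"
    using B unfolding is_base_def openin_topology_base_unique by blast
  have closure: "V \<subseteq> X closure_of V" if "V \<in> B" for V
    using open_B[OF that] by (simp add: closure_of_subset openin_subset)
  let ?P = "\<lambda>n V. V \<in> B \<and> x \<in> V \<and> V \<subseteq> C n"
  have "\<exists>U. \<forall>n. ?P n (U n) \<and> X closure_of U (Suc n) \<subseteq> U n"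
  proof (rule dependent_nat_choice)
    show "\<exists>V. ?P 0 V"
      using ex_base_element_closure_subset[OF X B C[of 0], of x] S(2) closure unfolding S_eq by blast
  next
    fix U n assume U: "?P n U"
    have "openin X (U \<inter> C (Suc n))" using U open_B C by blast
    moreover have "x \<in> U \<inter> C (Suc n)" using U S(2) unfolding S_eq by blast
    ultimately obtain V where V: "V \<in> B" "x \<in> V" "X closure_of V \<subseteq> U \<inter> C (Suc n)"
      using ex_base_element_closure_subset[OF X B] by blast
    then show "\<exists>V. ?P (Suc n) V \<and> X closure_of V \<subseteq> U"
      using closure[OF V(1)] by blast
  qed
  then obtain U where U: "\<And>n. ?P n (U n)" "\<And>n. X closure_of U (Suc n) \<subseteq> U n" by blast
  have "nested X U" unfolding nested_def using U open_B by blast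
  moreover have "range U \<subseteq> B" "x \<in> (\<Inter>n. U n)" "(\<Inter>n. U n) \<subseteq> S"
    using U(1) unfolding S_eq by blast+
  ultimately show ?thesis unfolding nested_intersections_def by blast
qed

text \<open>The \<open>G\<^sub>\<delta>\<close> sets are closed under finite intersections, so they form a base and not only a
  subbase of the topology that they generate.\<close>

lemma openin_G_delta_modification_contains_gdelta:
  assumes "openin (G_delta_modification X) W" "x \<in> W"
  shows "\<exists>S. gdelta_in X S \<and> x \<in> S \<and> S \<subseteq> W"
proof -
  have "generate_topology_on {S. gdelta_in X S} W"
    using assms(1) unfolding G_delta_modification_def openin_topology_generated_by_iff .
  then show ?thesis using assms(2)
  proof (induction arbitrary: x)
    case (Int a b)
    then obtain S T where "gdelta_in X S" "x \<in> S" "S \<subseteq> a" "gdelta_in X T" "x \<in> T" "T \<subseteq> b"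
      by (meson IntD1 IntD2)
    then show ?case by (intro exI[of _ "S \<inter> T"]) (auto intro: gdelta_in_Int)
  next
    case (UN K)
    then show ?case by (meson Union_iff Union_upper order_trans)
  qed auto
qed

lemma is_base_nested_intersections:
  assumes X: "regular_space X" and B: "is_base B X"
  shows "is_base (nested_intersections B X) (G_delta_modification X)"
  unfolding is_base_def openin_topology_base_unique
proof (intro conjI allI impI)
  fix G assume "G \<in> nested_intersections B X"
  then obtain U where U: "nested X U" "G = (\<Inter>n. U n)"
    unfolding nested_intersections_def by blast
  have "gdelta_in X G"
    unfolding U(2) using U(1)
    by (intro gdelta_in_Inter) (auto simp: nested_def intro: open_imp_gdelta_in)
  then show "openin (G_delta_modification X) G"
    unfolding G_delta_modification_def by (simp add: topology_generated_by_Basis)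
next
  fix W x assume "openin (G_delta_modification X) W \<and> x \<in> W"
  then obtain S where "gdelta_in X S" "x \<in> S" "S \<subseteq> W"
    using openin_G_delta_modification_contains_gdelta by metis
  then show "\<exists>G. G \<in> nested_intersections B X \<and> x \<in> G \<and> G \<subseteq> W"
    using gdelta_contains_nested_intersection[OF X B] by (meson order_trans)
qed

text \<open>Any member of the base above \<open>G\<close> is given by a sequence in the set \<open>D\<close> below, which is
  determined by one fixed nested sequence for \<open>G\<close>.\<close>

lemma op_like_nested_intersections:
  fixes r :: "'k rel" and B :: "'a set set"
  assumes X: "compact_space X" and op: "op_like r B"
    and r: "Cinfinite r" and cof: "natLeq <o cofinality r"
    and pow: "\<forall>l :: 'k rel. Cinfinite l \<and> l <o r \<longrightarrow> l ^c natLeq \<le>o r"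
  shows "op_like (cardSuc r) (nested_intersections B X)"
  unfolding op_like_def
proof
  fix G assume "G \<in> nested_intersections B X"
  then obtain U where U: "range U \<subseteq> B" "nested X U" "G = (\<Inter>n. U n)"
    unfolding nested_intersections_def by blast
  define D where "D = (\<Union>m. {V \<in> B. U m \<subseteq> V})"
  let ?above = "{H \<in> nested_intersections B X. G \<subseteq> H}"
  have "|D| <o r"
    unfolding D_def using U(1) op by (intro card_of_countable_UN_ordLess[OF r cof]) (auto simp: op_like_def)
  then have "|{s :: nat \<Rightarrow> 'a set. range s \<subseteq> D}| \<le>o r"
    by (rule card_of_sequences_ordLeq[OF pow r natLeq_ordLess_if_uncountable_cofinality[OF r cof]])
  moreover have "?above \<subseteq> (\<lambda>s :: nat \<Rightarrow> 'a set. \<Inter>n. s n) ` {s. range s \<subseteq> D}"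
  proof
    fix H assume "H \<in> ?above"
    then obtain V where V: "range V \<subseteq> B" "nested X V" "H = (\<Inter>n. V n)" and sub: "G \<subseteq> H"
      unfolding nested_intersections_def by blast
    have "V n \<in> D" for n
    proof -
      have "(\<Inter>m. U m) \<subseteq> V n" using sub unfolding U(3) V(3) by blast
      then obtain m where "U m \<subseteq> V n"
        using nested_intersection_subset_open[OF X U(2)] V(2) unfolding nested_def by blast
      then show ?thesis using V(1) unfolding D_def by blast
    qed
    then have "V \<in> {s. range s \<subseteq> D}" by (simp add: image_subset_iff)
    with V(3) show "H \<in> (\<lambda>s :: nat \<Rightarrow> 'a set. \<Inter>n. s n) ` {s. range s \<subseteq> D}"
      by (intro image_eqI[where x = V])
  qed
  ultimately have "|?above| \<le>o r" by (rule ordLeq_transitive[OF surj_imp_ordLeq, rotated])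
  then show "|?above| <o cardSuc r"
    using r by (simp add: cardSuc_ordLeq_ordLess card_of_Card_order)
qed

section \<open>The Noetherian type of the \<open>G\<^sub>\<delta>\<close>-modification\<close>

theorem theorem3p2:
  fixes X :: "'a topology"
  assumes "\<forall>l :: (nat + 'a set) set rel. Cinfinite l \<and> l <o Nt X \<longrightarrow> l ^c natLeq \<le>o Nt X"
    and "compact_space X" and "Hausdorff_space X"
    and "natLeq <o cofinality (Nt X)"
  shows "Nt (G_delta_modification X) \<le>o cardSuc (Nt X)"
proof -
  obtain B where B: "is_base B X" "op_like (Nt X) B"
    using Noetherian_type(2)[of X] unfolding has_op_like_base_def by blast
  have "is_base (nested_intersections B X) (G_delta_modification X)"
    using assms(2,3) B(1) by (intro is_base_nested_intersections compact_Hausdorff_imp_regular_space)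
  moreover have "op_like (cardSuc (Nt X)) (nested_intersections B X)"
    using assms(1,2,4) B(2) Noetherian_type(1) by (intro op_like_nested_intersections)
  ultimately have "has_op_like_base (cardSuc (Nt X)) (G_delta_modification X)"
    unfolding has_op_like_base_def by blast
  then show ?thesis
    by (rule Noetherian_type_least[OF Cinfinite_cardSuc[OF Noetherian_type(1)]])
qed

end
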